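(* If $T$ is a tree, then $\chi_D(T)=\chi_{D_\ell}(T)$.
   Context: A coloring of a graph $G$ is distinguishing if no nontrivial automorphism of $G$ preserves all vertex colors, and proper if adjacent vertices get different colors. The distinguishing chromatic number $\chi_D(G)$ is the minimum number of colors in a proper distinguishing coloring of $G$. Given lists $L=\{L(v)\}_{v\in V(G)}$, $G$ is properly $L$-distinguishable if there is a proper distinguishing coloring $f$ with $f(v)\in L(v)$ for all $v$. The list distinguishing chromatic number $\chi_{D_\ell}(G)$ is the minimum integer $k$ such that $G$ is properly $L$-distinguishable for every list assignment $L$ with $|L(v)|\ge k$ for all $v$. *)

theory Defs
  imports "Graph_Theory.Graph_Theory"
begin

text \<open>
  A finite simple undirected graph is a \<^locale>\<open>pair_graph\<close>: a finite, loop-free digraph with a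
  symmetric arc set.  The library's predicate \<^const>\<open>tree\<close> is unsuitable for this representation:
  there every edge, traversed back and forth, is a directed cycle of length 2.  The cycles of the
  undirected graph are the directed cycles of length at least 3.
\<close>

definition undirected_tree :: "'a pair_pre_digraph \<Rightarrow> bool" where
  "undirected_tree G \<longleftrightarrow>
     pair_graph G \<and>
     connected (with_proj G) \<and>
     \<not> (\<exists>p. pre_digraph.cycle (with_proj G) p \<and> 3 \<le> length p)"

definition graph_automorphism :: "'a pair_pre_digraph \<Rightarrow> ('a \<Rightarrow> 'a) \<Rightarrow> bool" where
  "graph_automorphism G \<phi> \<longleftrightarrow>
     bij_betw \<phi> (pverts G) (pverts G) \<and>
     (\<forall>u\<in>pverts G. \<forall>v\<in>pverts G. (u, v) \<in> parcs G \<longleftrightarrow> (\<phi> u, \<phi> v) \<in> parcs G)"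

definition proper_coloring :: "'a pair_pre_digraph \<Rightarrow> ('a \<Rightarrow> 'c) \<Rightarrow> bool" where
  "proper_coloring G f \<longleftrightarrow> (\<forall>(u, v)\<in>parcs G. f u \<noteq> f v)"

definition distinguishing_coloring :: "'a pair_pre_digraph \<Rightarrow> ('a \<Rightarrow> 'c) \<Rightarrow> bool" where
  "distinguishing_coloring G f \<longleftrightarrow>
     \<not> (\<exists>\<phi>. graph_automorphism G \<phi> \<and> (\<exists>v\<in>pverts G. \<phi> v \<noteq> v) \<and>
            (\<forall>v\<in>pverts G. f (\<phi> v) = f v))"

text \<open>Colors are natural numbers, which is no restriction for finite graphs.\<close>

definition distinguishing_chromatic_number :: "'a pair_pre_digraph \<Rightarrow> nat" ("\<chi>\<^sub>D") where
  "\<chi>\<^sub>D G = (LEAST k. \<exists>f :: 'a \<Rightarrow> nat.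
     proper_coloring G f \<and> distinguishing_coloring G f \<and> card (f ` pverts G) = k)"

definition properly_list_distinguishable :: "'a pair_pre_digraph \<Rightarrow> ('a \<Rightarrow> 'c set) \<Rightarrow> bool" where
  "properly_list_distinguishable G L \<longleftrightarrow>
     (\<exists>f. proper_coloring G f \<and> distinguishing_coloring G f \<and> (\<forall>v\<in>pverts G. f v \<in> L v))"

text \<open>Lists may be infinite; the disjunct \<^term>\<open>infinite (L v)\<close> is needed because
  \<^const>\<open>card\<close> is 0 on infinite sets.\<close>

definition list_distinguishing_chromatic_number :: "'a pair_pre_digraph \<Rightarrow> nat" ("\<chi>\<^sub>D\<^sub>l") where
  "\<chi>\<^sub>D\<^sub>l G = (LEAST k. \<forall>L :: 'a \<Rightarrow> nat set.
     (\<forall>v\<in>pverts G. infinite (L v) \<or> k \<le> card (L v)) \<longrightarrow> properly_list_distinguishable G L)"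

text \<open>Both minima range over nonempty sets, so \<^const>\<open>Least\<close> is meaningful.\<close>

lemma inj_on_proper_distinguishing:
  assumes "pair_graph G" and inj: "inj_on f (pverts G)"
  shows "proper_coloring G f" and "distinguishing_coloring G f"
proof -
  interpret pair_graph G by fact
  show "proper_coloring G f"
    unfolding proper_coloring_def
  proof (intro ballI, clarify)
    fix u v assume "(u, v) \<in> parcs G" "f u = f v"
    then show False
      using inj_onD[OF inj, of u v] in_arcsD1 in_arcsD2 pair_no_loops[of "(u, v)"] by simp
  qed
  show "distinguishing_coloring G f"
    unfolding distinguishing_coloring_def graph_automorphism_def
  proof clarify
    fix \<phi> v
    assume "bij_betw \<phi> (pverts G) (pverts G)" "v \<in> pverts G" "\<phi> v \<noteq> v"
      "\<forall>v\<in>pverts G. f (\<phi> v) = f v"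
    then show False
      using inj_onD[OF inj, of "\<phi> v" v] by (auto dest: bij_betwE)
  qed
qed

lemma distinguishing_chromatic_number_attained:
  assumes "pair_graph G"
  shows "\<exists>f :: 'a \<Rightarrow> nat. proper_coloring G f \<and> distinguishing_coloring G f \<and>
           card (f ` pverts (G :: 'a pair_pre_digraph)) = \<chi>\<^sub>D G"
proof -
  interpret pair_graph G by fact
  obtain f :: "'a \<Rightarrow> nat" where "inj_on f (pverts G)"
    using finite_imp_inj_to_nat_seg[OF pair_finite_verts] by blast
  then show ?thesis
    unfolding distinguishing_chromatic_number_def
    using inj_on_proper_distinguishing[OF assms]
    by (intro LeastI_ex[where P = "\<lambda>k. \<exists>f :: 'a \<Rightarrow> nat. proper_coloring G f \<and>
      distinguishing_coloring G f \<and> card (f ` pverts G) = k"]) blast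
qed

lemma inj_choice_from_lists:
  assumes "finite A" "\<And>v. v \<in> A \<Longrightarrow> infinite (L v) \<or> card A \<le> card (L v)"
  shows "\<exists>f. inj_on f A \<and> (\<forall>v\<in>A. f v \<in> L v)"
  using assms
proof (induction A rule: finite_induct)
  case empty
  then show ?case by simp
next
  case (insert x A)
  have "infinite (L v) \<or> card A \<le> card (L v)" if "v \<in> A" for v
    using insert.prems[of v] insert.hyps that by auto
  then obtain f where f: "inj_on f A" "\<forall>v\<in>A. f v \<in> L v"
    using insert.IH by blast
  have "\<not> L x \<subseteq> f ` A"
  proof
    assume "L x \<subseteq> f ` A"
    then have "finite (L x)" "card (L x) \<le> card A"
      using insert.hyps(1) by (auto intro: finite_subset dest: surj_card_le)
    then show False
      using insert.prems[of x] insert.hyps by simp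
  qed
  then obtain c where c: "c \<in> L x" "c \<notin> f ` A" by blast
  have eq: "\<forall>v\<in>A. (f(x := c)) v = f v"
    using insert.hyps(2) by auto
  have "inj_on (f(x := c)) (insert x A)"
    using f(1) c(2) insert.hyps(2) by (auto simp: inj_on_def)
  moreover have "\<forall>v\<in>insert x A. (f(x := c)) v \<in> L v"
    using f(2) c(1) eq by simp
  ultimately show ?case by blast
qed

lemma list_distinguishing_chromatic_number_attained:
  assumes "pair_graph G"
  shows "\<forall>L :: 'a \<Rightarrow> nat set.
           (\<forall>v\<in>pverts G. infinite (L v) \<or> \<chi>\<^sub>D\<^sub>l G \<le> card (L v)) \<longrightarrow>
           properly_list_distinguishable (G :: 'a pair_pre_digraph) L"
proof -
  interpret pair_graph G by fact
  have "\<forall>L :: 'a \<Rightarrow> nat set. (\<forall>v\<in>pverts G. infinite (L v) \<or> card (pverts G) \<le> card (L v)) \<longrightarrow>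
          properly_list_distinguishable G L"
  proof (intro allI impI)
    fix L :: "'a \<Rightarrow> nat set"
    assume L: "\<forall>v\<in>pverts G. infinite (L v) \<or> card (pverts G) \<le> card (L v)"
    have "\<exists>f. inj_on f (pverts G) \<and> (\<forall>v\<in>pverts G. f v \<in> L v)"
      by (rule inj_choice_from_lists[OF pair_finite_verts]) (rule bspec[OF L])
    then obtain f where f: "inj_on f (pverts G)" "\<forall>v\<in>pverts G. f v \<in> L v"
      by (elim exE conjE)
    show "properly_list_distinguishable G L"
      unfolding properly_list_distinguishable_def
      by (intro exI conjI) (fact inj_on_proper_distinguishing[OF assms f(1)] f(2))+
  qed
  then show ?thesis
    unfolding list_distinguishing_chromatic_number_def by (rule LeastI)
qed

end

theory Submission
  imports Defs "HOL-Library.Multiset"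
begin

text \<open>
  Stripping leaves repeatedly yields a vertex \<open>x\<close> (in the centre) that every automorphism of the
  tree fixes or maps to a neighbour.  An automorphism preserving a proper colouring cannot map
  \<open>x\<close> to a neighbour, so we may root the tree at \<open>x\<close> and consider rooted symmetries only.

  The isomorphism class of a coloured rooted tree is the tree \<open>map_rtree f t\<close> with unordered
  branches and colours as labels.  A colouring has no rooted symmetry iff all siblings in this
  tree are distinct.  Given the colour of a vertex, the classes for its subtree correspond to the
  transversals of the families of classes available to its children.  If \<open>m\<close> isomorphic branches
  have at least \<open>n\<close> classes each, they admit at least \<open>n choose m\<close> transversals, with equality
  if all branches share the same \<open>n\<close> classes, as is the case for equal lists.  Hence, inductively,
  arbitrary lists of size \<open>k\<close> allow at least as many classes as \<open>k\<close> common colours do.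
\<close>

section \<open>Counting transversals\<close>

text \<open>Images are collected instead of choice functions, since unordered branches do not record
  which child received which class.\<close>

definition transversals :: "('i \<Rightarrow> 'b set) \<Rightarrow> 'i set \<Rightarrow> 'b set set" where
  "transversals A I = {g ` I | g. inj_on g I \<and> (\<forall>i\<in>I. g i \<in> A i)}"

lemma transversals_empty [simp]: "transversals A {} = {{}}"
  by (auto simp: transversals_def)

lemma transversals_subset_Pow: "transversals A I \<subseteq> Pow (\<Union>i\<in>I. A i)"
  by (auto simp: transversals_def)

lemma finite_transversals:
  assumes "finite I" "\<And>i. i \<in> I \<Longrightarrow> finite (A i)"
  shows "finite (transversals A I)"
  using finite_subset[OF transversals_subset_Pow[of A I]] assms by simp

text \<open>Pascal's rule: fix an element \<open>x\<close> of some \<open>A i\<close> and split the transversals into those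
  in which \<open>x\<close> represents \<open>A i\<close> and those avoiding \<open>x\<close>.\<close>

lemma binomial_le_card_transversals:
  assumes "finite I" "\<And>i. i \<in> I \<Longrightarrow> finite (A i)" "\<And>i. i \<in> I \<Longrightarrow> n \<le> card (A i)"
  shows "n choose card I \<le> card (transversals A I)"
  using assms
proof (induction n arbitrary: I A)
  case 0
  then show ?case by (cases "card I") auto
next
  case (Suc n)
  show ?case
  proof (cases "I = {}")
    case False
    then obtain i where i: "i \<in> I" by blast
    then obtain x where x: "x \<in> A i"
      using Suc.prems(3)[of i] by fastforce
    let ?B = "\<lambda>j. A j - {x}" and ?J = "I - {i}"
    have fin: "finite (transversals ?B I)" "finite (transversals ?B ?J)"
      by (rule finite_transversals; use Suc.prems in simp)+
    \<comment> \<open>Removing \<open>x\<close> costs each set at most one element, which the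
      passage from \<open>Suc n\<close> to \<open>n\<close> pays for.\<close>
    have n: "n \<le> card (?B j)" if "j \<in> I" for j
      using Suc.prems(2,3)[OF that] by (auto simp: card_Diff_singleton_if)
    have x_notin: "x \<notin> X" if "X \<in> transversals ?B J" for X J
      using that by (auto simp: transversals_def)
    have inj: "inj_on (insert x) (transversals ?B ?J)"
      by (rule inj_onI) (metis x_notin insert_ident)
    have "insert x ` transversals ?B ?J \<subseteq> transversals A I"
    proof
      fix X assume "X \<in> insert x ` transversals ?B ?J"
      then obtain g where g: "X = insert x (g ` ?J)" "inj_on g ?J" "\<forall>j\<in>?J. g j \<in> ?B j"
        by (auto simp: transversals_def)
      have "X = (g(i := x)) ` I" using g(1) i by auto
      moreover have "inj_on (g(i := x)) I"
        using g(2,3) by (fastforce simp: inj_on_def)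
      moreover have "\<forall>j\<in>I. (g(i := x)) j \<in> A j" using g(3) x by auto
      ultimately show "X \<in> transversals A I"
        unfolding transversals_def by blast
    qed
    moreover have "transversals ?B I \<subseteq> transversals A I"
      unfolding transversals_def by blast
    ultimately have "insert x ` transversals ?B ?J \<union> transversals ?B I \<subseteq> transversals A I"
      by blast
    then have "card (insert x ` transversals ?B ?J \<union> transversals ?B I) \<le> card (transversals A I)"
      by (intro card_mono finite_transversals Suc.prems)
    moreover have "card (insert x ` transversals ?B ?J \<union> transversals ?B I)
        = card (transversals ?B ?J) + card (transversals ?B I)"
      using fin x_notin card_image[OF inj] by (subst card_Un_disjoint) auto
    moreover have "n choose card ?J \<le> card (transversals ?B ?J)"
      by (rule Suc.IH) (use Suc.prems n in auto)
    moreover have "n choose card I \<le> card (transversals ?B I)"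
      by (rule Suc.IH) (use Suc.prems n in auto)
    moreover have "Suc n choose card I = (n choose card ?J) + (n choose card I)"
      using i Suc.prems(1) by (cases "card I") (auto simp: card_Diff_singleton_if)
    ultimately show ?thesis by linarith
  qed simp
qed

text \<open>By injectivity of the choice, every transversal is a subset of \<open>B\<close> with
  exactly \<open>card I\<close> elements.\<close>

lemma card_transversals_le_binomial:
  assumes "finite I" "finite B" "\<And>i. i \<in> I \<Longrightarrow> A i = B"
  shows "card (transversals A I) \<le> card B choose card I"
proof -
  have "transversals A I \<subseteq> {X. X \<subseteq> B \<and> card X = card I}"
    using assms(3) by (auto simp: transversals_def card_image)
  then have "card (transversals A I) \<le> card {X. X \<subseteq> B \<and> card X = card I}"
    by (rule card_mono[rotated]) (simp add: assms(2))
  then show ?thesis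
    using n_subsets[OF assms(2)] by simp
qed

text \<open>The restrictions of a choice function to \<open>I\<close> and to \<open>J\<close> give
  two transversals whose union is the given one, so taking unions is onto.\<close>

lemma card_transversals_Un_le:
  assumes "finite I" "finite J" "\<And>i. i \<in> I \<union> J \<Longrightarrow> finite (B i)"
  shows "card (transversals B (I \<union> J)) \<le> card (transversals B I) * card (transversals B J)"
proof -
  have "transversals B (I \<union> J) \<subseteq> (\<lambda>(X, Y). X \<union> Y) ` (transversals B I \<times> transversals B J)"
  proof
    fix Z assume "Z \<in> transversals B (I \<union> J)"
    then obtain g where g: "Z = g ` (I \<union> J)" "inj_on g (I \<union> J)" "\<forall>i\<in>I \<union> J. g i \<in> B i"
      by (auto simp: transversals_def)
    then have "g ` I \<in> transversals B I" "g ` J \<in> transversals B J"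
      by (auto simp: transversals_def inj_on_Un)
    moreover have "Z = g ` I \<union> g ` J" using g(1) by (simp add: image_Un)
    ultimately show "Z \<in> (\<lambda>(X, Y). X \<union> Y) ` (transversals B I \<times> transversals B J)"
      by blast
  qed
  then have "card (transversals B (I \<union> J)) \<le> card (transversals B I \<times> transversals B J)"
    by (rule surj_card_le[rotated]) (use assms in \<open>auto intro!: finite_transversals\<close>)
  then show ?thesis by (simp add: card_cartesian_product)
qed

text \<open>Disjointness of the values lets \<open>X\<close> and \<open>Y\<close> be recovered from
  \<open>X \<union> Y\<close> and lets the two choice functions be combined injectively.\<close>

lemma card_transversals_Un_ge:
  assumes "finite I" "finite J" "I \<inter> J = {}" "\<And>i. i \<in> I \<union> J \<Longrightarrow> finite (A i)"
    and disj: "\<And>i j. i \<in> I \<Longrightarrow> j \<in> J \<Longrightarrow> A i \<inter> A j = {}"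
  shows "card (transversals A I) * card (transversals A J) \<le> card (transversals A (I \<union> J))"
proof -
  let ?U = "\<lambda>(X, Y). X \<union> Y" and ?P = "transversals A I \<times> transversals A J"
  have sub: "X \<subseteq> (\<Union>i\<in>K. A i)" if "X \<in> transversals A K" for X K
    using that transversals_subset_Pow[of A K] by blast
  have UIJ: "(\<Union>i\<in>I. A i) \<inter> (\<Union>j\<in>J. A j) = {}" using disj by blast
  have inj: "inj_on ?U ?P"
  proof (rule inj_onI, clarsimp)
    fix X Y X' Y'
    assume "X \<in> transversals A I" "Y \<in> transversals A J" "X' \<in> transversals A I"
      "Y' \<in> transversals A J" and eq: "X \<union> Y = X' \<union> Y'"
    note s = this(1-4)[THEN sub]
    show "X = X' \<and> Y = Y'" using s eq UIJ by blast
  qed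
  have "?U ` ?P \<subseteq> transversals A (I \<union> J)"
  proof clarify
    fix X Y assume X: "X \<in> transversals A I" and Y: "Y \<in> transversals A J"
    obtain g where g: "X = g ` I" "inj_on g I" "\<forall>i\<in>I. g i \<in> A i"
      using X by (auto simp: transversals_def)
    obtain h where h: "Y = h ` J" "inj_on h J" "\<forall>i\<in>J. h i \<in> A i"
      using Y by (auto simp: transversals_def)
    let ?k = "\<lambda>i. if i \<in> I then g i else h i"
    have eqJ: "?k j = h j" if "j \<in> J" for j using that assms(3) by auto
    have "X \<inter> Y = {}" using sub[OF X] sub[OF Y] UIJ by blast
    moreover have "?k ` I = X" "?k ` J = Y" unfolding g(1) h(1) using eqJ by auto
    moreover have "inj_on ?k I" using g(2) by (simp add: inj_on_def)
    moreover have "inj_on ?k J" using h(2) eqJ by (simp add: inj_on_def)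
    ultimately have "X \<union> Y = ?k ` (I \<union> J) \<and> inj_on ?k (I \<union> J)"
      using assms(3) by (auto simp: inj_on_Un)
    moreover have "\<forall>i\<in>I \<union> J. ?k i \<in> A i" using g(3) h(3) by auto
    ultimately show "X \<union> Y \<in> transversals A (I \<union> J)"
      unfolding transversals_def by blast
  qed
  then have "card (?U ` ?P) \<le> card (transversals A (I \<union> J))"
    by (rule card_mono[rotated]) (use assms in \<open>auto intro!: finite_transversals\<close>)
  then show ?thesis
    using card_image[OF inj] by (simp add: card_cartesian_product)
qed

text \<open>\<open>\<sigma>\<close> plays the role of an isomorphism type. Within one type the sets
  \<open>B i\<close> coincide, so the binomial bounds compare \<open>B\<close> with \<open>A\<close>
  there. Across types the product of the counts is an upper bound for \<open>B\<close> and a lower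
  bound for \<open>A\<close>. The induction removes one whole type at a time.\<close>

lemma card_transversals_mono:
  assumes "finite I" "\<And>i. i \<in> I \<Longrightarrow> finite (A i)" "\<And>i. i \<in> I \<Longrightarrow> finite (B i)"
    and le: "\<And>i. i \<in> I \<Longrightarrow> card (B i) \<le> card (A i)"
    and same: "\<And>i j. i \<in> I \<Longrightarrow> j \<in> I \<Longrightarrow> \<sigma> i = \<sigma> j \<Longrightarrow> B i = B j"
    and disj: "\<And>i j. i \<in> I \<Longrightarrow> j \<in> I \<Longrightarrow> \<sigma> i \<noteq> \<sigma> j \<Longrightarrow> A i \<inter> A j = {}"
  shows "card (transversals B I) \<le> card (transversals A I)"
  using assms
proof (induction I rule: finite_psubset_induct)
  case (psubset I)
  show ?case
  proof (cases "I = {}")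
    case False
    then obtain i where i: "i \<in> I" by blast
    define C where "C = {j \<in> I. \<sigma> j = \<sigma> i}"
    define J where "J = I - C"
    have IC: "I = C \<union> J" "C \<inter> J = {}" "C \<subseteq> I" "J \<subset> I" "i \<in> C"
      using i by (auto simp: C_def J_def)
    have fin: "finite C" "finite J"
      using IC psubset.hyps(1) by (auto intro: finite_subset)
    have "B j = B i" if "j \<in> C" for j
      by (rule psubset.prems(4)) (use i that in \<open>auto simp: C_def\<close>)
    then have "card (transversals B C) \<le> card (B i) choose card C"
      using card_transversals_le_binomial[OF fin(1) psubset.prems(2)[OF i]] by blast
    also have "\<dots> \<le> card (transversals A C)"
    proof (rule binomial_le_card_transversals[OF fin(1)])
      fix j assume "j \<in> C"
      then have j: "j \<in> I" "\<sigma> j = \<sigma> i" by (auto simp: C_def)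
      show "finite (A j)" using psubset.prems(1) j by blast
      show "card (B i) \<le> card (A j)"
        using psubset.prems(3)[OF j(1)] psubset.prems(4)[OF j(1) i j(2)] by simp
    qed
    finally have C: "card (transversals B C) \<le> card (transversals A C)" .
    have JI: "j \<in> I" if "j \<in> J" for j using that IC(4) by blast
    have J: "card (transversals B J) \<le> card (transversals A J)"
      by (rule psubset.IH[OF IC(4)]) (rule psubset.prems, (erule JI)+, assumption?)+
    have "card (transversals B I) \<le> card (transversals B C) * card (transversals B J)"
      using card_transversals_Un_le[OF fin, of B] IC(1) psubset.prems(2) by simp
    also have "\<dots> \<le> card (transversals A C) * card (transversals A J)"
      using C J by (rule mult_le_mono)
    also have "\<dots> \<le> card (transversals A I)"
    proof -
      have "A a \<inter> A b = {}" if "a \<in> C" "b \<in> J" for a b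
        by (rule psubset.prems(5)) (use that in \<open>auto simp: C_def J_def\<close>)
      then show ?thesis
        using card_transversals_Un_ge[OF fin IC(2), of A] IC(1) psubset.prems(1) by simp
    qed
    finally show ?thesis .
  qed simp
qed

section \<open>Rooted trees with unordered branches\<close>

definition uniq_mset :: "'b multiset \<Rightarrow> bool" where
  "uniq_mset M \<longleftrightarrow> mset_set (set_mset M) = M"

lemma card_set_mset_le_size: "card (set_mset M) \<le> size M"
  using size_mset_mono[OF mset_set_set_mset_msubset[of M]] by simp

text \<open>\<open>mset_set (set_mset M)\<close> is always contained in \<open>M\<close>, so equal
  sizes force equality.\<close>

lemma uniq_mset_iff_card: "uniq_mset M \<longleftrightarrow> card (set_mset M) = size M"
proof
  assume "card (set_mset M) = size M"
  then have "\<not> mset_set (set_mset M) \<subset># M"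
    using mset_subset_size[of "mset_set (set_mset M)" M] by auto
  then show "uniq_mset M"
    unfolding uniq_mset_def
    using mset_set_set_mset_msubset[of M] subset_mset.le_imp_less_or_eq by blast
qed (metis uniq_mset_def size_mset_set)

text \<open>Counting can shrink twice: from \<open>size M\<close> to the number of distinct
  elements, and again under \<open>h\<close>. The two ends agree iff neither step shrinks.\<close>

lemma uniq_mset_image_iff:
  "uniq_mset (image_mset h M) \<longleftrightarrow> uniq_mset M \<and> inj_on h (set_mset M)"
proof -
  have "card (h ` set_mset M) = card (set_mset M) \<longleftrightarrow> inj_on h (set_mset M)"
    by (meson card_image eq_card_imp_inj_on finite_set_mset)
  then show ?thesis
    using card_image_le[of "set_mset M" h] card_set_mset_le_size[of M]
    by (auto simp: uniq_mset_iff_card)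
qed

lemma uniq_mset_set [simp]: "finite X \<Longrightarrow> uniq_mset (mset_set X)"
  by (simp add: uniq_mset_def)

lemma uniq_mset_eqI:
  "uniq_mset M \<Longrightarrow> uniq_mset N \<Longrightarrow> set_mset M = set_mset N \<Longrightarrow> M = N"
  by (metis uniq_mset_def)

lemma uniq_mset_add_iff: "uniq_mset (add_mset x M) \<longleftrightarrow> uniq_mset M \<and> x \<notin># M"
  using card_set_mset_le_size[of M]
  by (auto simp: uniq_mset_iff_card card_insert_if)

section \<open>Trees, their edges and their relabellings\<close>

text \<open>Branching through multisets makes equality of trees ignore the order of branches. Labels
  serve as vertices, as colours or, of type \<open>unit\<close>, to leave the bare shape.\<close>

datatype 'a rtree = RNode (root: 'a) "'a rtree multiset"

lemma finite_set_rtree [simp]: "finite (set_rtree t)"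
  by (induction t) auto

lemma root_in_set_rtree [simp]: "root t \<in> set_rtree t"
  by (cases t) auto

lemma root_map_rtree [simp]: "root (map_rtree f t) = f (root t)"
  by (cases t) auto

primrec edges :: "'a rtree \<Rightarrow> ('a \<times> 'a) set" where
  "edges (RNode a M) = (\<lambda>S. (a, root S)) ` set_mset M \<union> \<Union> (set_mset (image_mset edges M))"

lemma edges_subset: "edges t \<subseteq> set_rtree t \<times> set_rtree t"
  by (induction t) fastforce

lemma edges_map_rtree: "edges (map_rtree f t) = map_prod f f ` edges t"
  by (induction t) (auto simp: image_Un image_UN image_image)

abbreviation uedges :: "'a rtree \<Rightarrow> ('a \<times> 'a) set" where
  "uedges t \<equiv> edges t \<union> (edges t)\<inverse>"

lemma uedges_map_rtree: "uedges (map_rtree f t) = map_prod f f ` uedges t"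
  by (auto simp: edges_map_rtree)

text \<open>\<open>uniq_mset M\<close> is a separate clause because disjointness of different
  branches does not exclude two copies of the same branch.\<close>

inductive distinct_labels :: "'a rtree \<Rightarrow> bool" where
  "(\<And>S. S \<in># M \<Longrightarrow> distinct_labels S) \<Longrightarrow> (\<And>S. S \<in># M \<Longrightarrow> a \<notin> set_rtree S) \<Longrightarrow> uniq_mset M \<Longrightarrow>
   (\<And>S S'. S \<in># M \<Longrightarrow> S' \<in># M \<Longrightarrow> S \<noteq> S' \<Longrightarrow> set_rtree S \<inter> set_rtree S' = {}) \<Longrightarrow>
   distinct_labels (RNode a M)"

lemma distinct_labels_RNode:
  "distinct_labels (RNode a M) \<longleftrightarrow>
     (\<forall>S\<in>#M. distinct_labels S \<and> a \<notin> set_rtree S) \<and> uniq_mset M \<and>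
     (\<forall>S\<in>#M. \<forall>S'\<in>#M. S \<noteq> S' \<longrightarrow> set_rtree S \<inter> set_rtree S' = {})"
  by (subst distinct_labels.simps) (simp, blast)

lemma distinct_labels_child_eqI:
  assumes "distinct_labels (RNode a M)" "S \<in># M" "S' \<in># M" "v \<in> set_rtree S" "v \<in> set_rtree S'"
  shows "S = S'"
  using assms unfolding distinct_labels_RNode by blast

text \<open>Distinct image labels separate the root from the branches and the images of different
  branches from each other. Two vertices with the same image therefore lie in one branch, where
  induction applies.\<close>

lemma inj_on_if_distinct_labels_map:
  "distinct_labels (map_rtree h t) \<Longrightarrow> inj_on h (set_rtree t)"
proof (induction t)
  case (RNode a M)
  have inj: "inj_on (map_rtree h) (set_mset M)"
    using RNode.prems by (simp add: distinct_labels_RNode uniq_mset_image_iff)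
  have ne: "h a \<noteq> h q" if "S \<in># M" "q \<in> set_rtree S" for S q
    using RNode.prems that by (force simp: distinct_labels_RNode rtree.set_map)
  show ?case
  proof (rule inj_onI)
    fix p q
    assume pq: "p \<in> set_rtree (RNode a M)" "q \<in> set_rtree (RNode a M)" "h p = h q"
    show "p = q"
    proof (cases "p = a \<or> q = a")
      case True
      then show ?thesis using pq ne by (auto dest: ne sym)
    next
      case False
      then obtain S S' where S: "S \<in># M" "p \<in> set_rtree S" "S' \<in># M" "q \<in> set_rtree S'"
        using pq by auto
      have "map_rtree h S = map_rtree h S'"
        using RNode.prems S pq(3)
        by (intro distinct_labels_child_eqI[of "h a" "image_mset (map_rtree h) M" _ _ "h p"])
          (auto simp: rtree.set_map intro: rev_image_eqI)
      then have "S = S'" using inj S by (auto dest: inj_onD)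
      moreover have "distinct_labels (map_rtree h S)"
        using RNode.prems S(1) by (simp add: distinct_labels_RNode)
      ultimately show ?thesis
        using RNode.IH[OF S(1)] S pq(3) by (auto dest: inj_onD)
    qed
  qed
qed

lemma distinct_labels_map:
  "distinct_labels t \<Longrightarrow> inj_on h (set_rtree t) \<Longrightarrow> distinct_labels (map_rtree h t)"
proof (induction t)
  case (RNode a M)
  have inj: "inj_on (map_rtree h) (set_mset M)"
  proof (rule inj_onI)
    fix S S' assume S: "S \<in># M" "S' \<in># M" "map_rtree h S = map_rtree h S'"
    \<comment> \<open>The root of \<open>S\<close> tells branches apart: equal images would put it
      into \<open>S'\<close> as well, by injectivity of \<open>h\<close>.\<close>
    then have "h (root S) \<in> h ` set_rtree S'"
      by (metis root_in_set_rtree image_eqI rtree.set_map)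
    moreover have "root S \<in> set_rtree (RNode a M)" "set_rtree S' \<subseteq> set_rtree (RNode a M)"
      using S root_in_set_rtree by fastforce+
    ultimately have "root S \<in> set_rtree S'"
      using RNode.prems(2) by (meson inj_on_image_mem_iff)
    then show "S = S'"
      using S distinct_labels_child_eqI[OF RNode.prems(1)] root_in_set_rtree by blast
  qed
  have sub: "inj_on h (set_rtree S)" if "S \<in># M" for S
    by (rule inj_on_subset[OF RNode.prems(2)]) (use that in auto)
  have a: "h a \<notin> h ` set_rtree S" if "S \<in># M" for S
    using RNode.prems that by (auto simp: distinct_labels_RNode inj_on_def)
  have disj: "h ` set_rtree S \<inter> h ` set_rtree S' = {}"
    if "S \<in># M" "S' \<in># M" "map_rtree h S \<noteq> map_rtree h S'" for S S'
  proof -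
    have "set_rtree S \<inter> set_rtree S' = {}"
      using distinct_labels_child_eqI[OF RNode.prems(1) that(1,2)] that(3) by blast
    moreover have "inj_on h (set_rtree S \<union> set_rtree S')"
      by (rule inj_on_subset[OF RNode.prems(2)]) (use that in auto)
    ultimately show ?thesis by (auto simp: inj_on_Un)
  qed
  show ?case
    unfolding rtree.map
  proof (rule distinct_labels.intros)
    show "uniq_mset (image_mset (map_rtree h) M)"
      using RNode.prems(1) inj by (simp add: distinct_labels_RNode uniq_mset_image_iff)
  next
    fix S assume "S \<in># image_mset (map_rtree h) M"
    then obtain R where "R \<in># M" "S = map_rtree h R" by auto
    then show "distinct_labels S" "h a \<notin> set_rtree S"
      using RNode.IH sub a RNode.prems(1) by (auto simp: distinct_labels_RNode rtree.set_map)
  next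
    fix S S' assume "S \<in># image_mset (map_rtree h) M" "S' \<in># image_mset (map_rtree h) M"
      and ne: "S \<noteq> S'"
    then obtain R R' where "R \<in># M" "R' \<in># M" "S = map_rtree h R" "S' = map_rtree h R'" by auto
    then show "set_rtree S \<inter> set_rtree S' = {}"
      using disj[of R R'] ne by (simp add: rtree.set_map)
  qed
qed

text \<open>Distinct labels on one side turn the label relation given by relational lifting into
  a function.\<close>

lemma map_rtree_eq_imp_transport:
  assumes "map_rtree f S = map_rtree f' S'" "distinct_labels S"
  obtains g where "map_rtree g S = S'" "\<And>v. v \<in> set_rtree S \<Longrightarrow> f' (g v) = f v"
proof -
  have "rel_rtree (\<lambda>a b. f a = f' b) S S'"
    using assms(1) by (simp flip: rtree.rel_eq add: rtree.rel_map)
  \<comment> \<open>The witness \<open>z\<close> has the shape of both trees, with each label of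
    \<open>S\<close> paired with its partner in \<open>S'\<close>.\<close>
  then obtain z where z: "set_rtree z \<subseteq> {(a, b). f a = f' b}" "map_rtree fst z = S" "map_rtree snd z = S'"
    unfolding rtree.in_rel by blast
  have inj: "inj_on fst (set_rtree z)"
    using assms(2) z(2) inj_on_if_distinct_labels_map by blast
  define g where "g = snd \<circ> inv_into (set_rtree z) fst"
  have g: "g (fst p) = snd p" if "p \<in> set_rtree z" for p
    using that inj by (simp add: g_def)
  show ?thesis
  proof
    show "map_rtree g S = S'"
      unfolding z(2,3)[symmetric] rtree.map_comp by (rule rtree.map_cong0) (simp add: g)
    fix v assume "v \<in> set_rtree S"
    then obtain p where "p \<in> set_rtree z" "v = fst p"
      unfolding z(2)[symmetric] rtree.set_map by blast
    then show "f' (g v) = f v" using z(1) g by auto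
  qed
qed

section \<open>Equal siblings and colour-preserving symmetries\<close>

inductive distinct_siblings :: "'c rtree \<Rightarrow> bool" where
  "(\<And>S. S \<in># M \<Longrightarrow> distinct_siblings S) \<Longrightarrow> uniq_mset M \<Longrightarrow> distinct_siblings (RNode c M)"

lemma distinct_siblings_RNode:
  "distinct_siblings (RNode c M) \<longleftrightarrow> (\<forall>S\<in>#M. distinct_siblings S) \<and> uniq_mset M"
  by (subst distinct_siblings.simps) auto

text \<open>\<open>\<phi>\<close> permutes the branches at the root and preserves their coloured
  classes. Since these classes differ between siblings, each branch is mapped to itself and
  induction applies inside it.\<close>

lemma map_rtree_fixed_imp_id:
  assumes "distinct_siblings (map_rtree f t)" "map_rtree \<phi> t = t"
    "\<And>v. v \<in> set_rtree t \<Longrightarrow> f (\<phi> v) = f v" "v \<in> set_rtree t"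
  shows "\<phi> v = v"
  using assms
proof (induction t rule: rtree.induct)
  case (RNode a M)
  have "image_mset (map_rtree \<phi>) M = M" using RNode.prems(2) by simp
  have inj: "inj_on (map_rtree f) (set_mset M)"
    using RNode.prems(1) by (simp add: distinct_siblings_RNode uniq_mset_image_iff)
  show ?case
  proof (cases "v = a")
    case False
    then obtain S where S: "S \<in># M" "v \<in> set_rtree S" using RNode.prems(4) by auto
    have inM: "map_rtree \<phi> S \<in># M"
      using S(1) \<open>image_mset (map_rtree \<phi>) M = M\<close> by (metis image_eqI set_image_mset)
    have eq: "f (\<phi> w) = f w" if "w \<in> set_rtree S" for w
      using RNode.prems(3) S(1) that by auto
    then have "map_rtree f (map_rtree \<phi> S) = map_rtree f S"
      unfolding rtree.map_comp by (intro rtree.map_cong0) simp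
    then have "map_rtree \<phi> S = S" using inj inM S(1) by (auto dest: inj_onD)
    moreover have "distinct_siblings (map_rtree f S)"
      using RNode.prems(1) S(1) by (simp add: distinct_siblings_RNode)
    ultimately show ?thesis using RNode.IH[OF S(1)] S(2) eq by blast
  qed (use RNode.prems(2) in simp)
qed

text \<open>A failure below the root yields a symmetry of one branch, extended by the identity; the
  last conjunct makes this extension possible. A failure at the root yields two branches of the same
  coloured class, which can be exchanged.\<close>

lemma not_distinct_siblings_imp_symmetry:
  assumes "distinct_labels t" "\<not> distinct_siblings (map_rtree f t)"
  shows "\<exists>\<phi>. map_rtree \<phi> t = t \<and> (\<forall>v\<in>set_rtree t. f (\<phi> v) = f v) \<and>
    (\<exists>v\<in>set_rtree t. \<phi> v \<noteq> v) \<and> (\<forall>v. v \<notin> set_rtree t \<longrightarrow> \<phi> v = v)"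
  using assms
proof (induction t rule: rtree.induct)
  case (RNode a M)
  have uM: "uniq_mset M" using RNode.prems(1) by (simp add: distinct_labels_RNode)
  note disj = distinct_labels_child_eqI[OF RNode.prems(1)]
  have a: "a \<notin> set_rtree S" if "S \<in># M" for S
    using RNode.prems(1) that by (simp add: distinct_labels_RNode)
  have idI: "map_rtree \<phi> R = R" if "\<And>v. v \<in> set_rtree R \<Longrightarrow> \<phi> v = v" for \<phi> :: "'a \<Rightarrow> 'a" and R
    using rtree.map_cong0[of R \<phi> id] that by (simp add: rtree.map_id)
  show ?case
  proof (cases "\<exists>S\<in>#M. \<not> distinct_siblings (map_rtree f S)")
    case True
    then obtain S where S: "S \<in># M" "\<not> distinct_siblings (map_rtree f S)" by blast
    moreover have "distinct_labels S"
      using RNode.prems(1) S(1) by (simp add: distinct_labels_RNode)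
    ultimately obtain \<phi> where \<phi>: "map_rtree \<phi> S = S" "\<forall>v\<in>set_rtree S. f (\<phi> v) = f v"
      "\<exists>v\<in>set_rtree S. \<phi> v \<noteq> v" "\<forall>v. v \<notin> set_rtree S \<longrightarrow> \<phi> v = v"
      using RNode.IH by blast
    have "map_rtree \<phi> R = R" if R: "R \<in># M" for R
    proof (cases "R = S")
      case False
      then have "v \<notin> set_rtree S" if "v \<in> set_rtree R" for v
        using disj[OF R S(1) that] by blast
      then show ?thesis using \<phi>(4) by (intro idI) blast
    qed (simp add: \<phi>(1))
    then have "image_mset (map_rtree \<phi>) M = M"
      by (simp add: multiset.map_ident_strong)
    moreover have "\<phi> a = a" using a[OF S(1)] \<phi>(4) by blast
    ultimately have "map_rtree \<phi> (RNode a M) = RNode a M" by simp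
    moreover have "\<forall>v. f (\<phi> v) = f v" using \<phi>(2,4) by metis
    ultimately show ?thesis
      using S(1) \<phi>(3,4) by (intro exI[of _ \<phi>]) auto
  next
    case False
    \<comment> \<open>No branch fails by itself here, so the failure is a repetition at this node;
      as \<open>M\<close> has no repetition, two different branches have the same image.\<close>
    then have "\<not> inj_on (map_rtree f) (set_mset M)"
      using RNode.prems(2) uM by (auto simp: distinct_siblings_RNode uniq_mset_image_iff)
    then obtain S S' where S: "S \<in># M" "S' \<in># M" "S \<noteq> S'" "map_rtree f S = map_rtree f S'"
      by (auto simp: inj_on_def)
    have dl: "distinct_labels S" "distinct_labels S'"
      using RNode.prems(1) S(1,2) by (simp_all add: distinct_labels_RNode)
    obtain g where g: "map_rtree g S = S'" "\<And>v. v \<in> set_rtree S \<Longrightarrow> f (g v) = f v"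
      using map_rtree_eq_imp_transport[OF S(4) dl(1)] by blast
    obtain g' where g': "map_rtree g' S' = S" "\<And>v. v \<in> set_rtree S' \<Longrightarrow> f (g' v) = f v"
      using map_rtree_eq_imp_transport[OF S(4)[symmetric] dl(2)] by blast
    \<comment> \<open>\<open>g\<close> and \<open>g'\<close> come from separate transports and need
      not be mutually inverse; only their effect on whole branches matters.\<close>
    define \<phi> where "\<phi> v = (if v \<in> set_rtree S then g v else if v \<in> set_rtree S' then g' v else v)" for v
    have SS': "v \<notin> set_rtree S" if "v \<in> set_rtree S'" for v
      using disj[OF S(2,1) that] S(3) by blast
    have \<phi>S: "map_rtree \<phi> S = S'"
      unfolding g(1)[symmetric] by (rule rtree.map_cong0) (simp add: \<phi>_def)
    have \<phi>S': "map_rtree \<phi> S' = S"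
      unfolding g'(1)[symmetric] by (rule rtree.map_cong0) (simp add: \<phi>_def SS')
    have \<phi>R: "map_rtree \<phi> R = R" if "R \<in># M" "R \<noteq> S" "R \<noteq> S'" for R
      using disj[OF that(1) S(1)] disj[OF that(1) S(2)] that(2,3)
      by (intro idI) (auto simp: \<phi>_def)
    have img: "map_rtree \<phi> ` set_mset M = set_mset M"
      using S(1,2) \<phi>S \<phi>S' \<phi>R by (auto simp: image_iff) metis+
    \<comment> \<open>A surjection of the finite set of branches onto itself is injective; with
      \<open>uniq_mset M\<close> this fixes the multiset and not only its support.\<close>
    moreover from img have "inj_on (map_rtree \<phi>) (set_mset M)"
      by (intro finite_surj_inj) auto
    ultimately have "image_mset (map_rtree \<phi>) M = M"
      using uM by (intro uniq_mset_eqI) (auto simp: uniq_mset_image_iff)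
    moreover have "\<phi> a = a" using a S(1,2) by (simp add: \<phi>_def)
    ultimately have "map_rtree \<phi> (RNode a M) = RNode a M" by simp
    moreover have "\<forall>v. f (\<phi> v) = f v" using g(2) g'(2) by (simp add: \<phi>_def)
    \<comment> \<open>The root of \<open>S\<close> goes to the root of \<open>S'\<close>, which lies
      outside \<open>S\<close>.\<close>
    moreover have "\<phi> (root S) \<noteq> root S"
    proof
      assume "\<phi> (root S) = root S"
      then have "root S' = root S" using \<phi>S by (metis root_map_rtree)
      then show False using SS' by (metis root_in_set_rtree)
    qed
    moreover have "root S \<in> set_rtree (RNode a M)" using S(1) root_in_set_rtree by fastforce
    moreover have "\<forall>v. v \<notin> set_rtree (RNode a M) \<longrightarrow> \<phi> v = v" using S(1,2) by (auto simp: \<phi>_def)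
    ultimately show ?thesis by blast
  qed
qed

section \<open>Counting list colourings\<close>

text \<open>Both conditions refer to the tree of colours alone, so whether a colouring is admissible
  depends only on its class.\<close>

definition good_code :: "'c rtree \<Rightarrow> bool" where
  "good_code z \<longleftrightarrow> (\<forall>(u, v)\<in>edges z. u \<noteq> v) \<and> distinct_siblings z"

lemma good_code_RNode:
  "good_code (RNode c M) \<longleftrightarrow> (\<forall>S\<in>#M. good_code S \<and> root S \<noteq> c) \<and> uniq_mset M"
  by (auto simp: good_code_def distinct_siblings_RNode)

text \<open>The colour-isomorphism classes of the proper, asymmetric colourings of \<^term>\<open>t\<close> from the
  lists \<^term>\<open>L\<close>.\<close>

definition codes :: "('a \<Rightarrow> 'c set) \<Rightarrow> 'a rtree \<Rightarrow> 'c rtree set" where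
  "codes L t = {map_rtree f t | f. (\<forall>v\<in>set_rtree t. f v \<in> L v) \<and> good_code (map_rtree f t)}"

lemma root_codes: "z \<in> codes L t \<Longrightarrow> root z \<in> L (root t)"
  by (auto simp: codes_def)

text \<open>A code depends on the colouring only through its restriction to the finitely many
  labels.\<close>

lemma finite_codes:
  assumes "\<And>v. v \<in> set_rtree t \<Longrightarrow> finite (L v)"
  shows "finite (codes L t)"
proof -
  have "codes L t \<subseteq> (\<lambda>f. map_rtree f t) ` (PiE (set_rtree t) L)"
  proof
    fix z assume "z \<in> codes L t"
    then obtain f where f: "z = map_rtree f t" "\<forall>v\<in>set_rtree t. f v \<in> L v"
      by (auto simp: codes_def)
    then have "z = map_rtree (restrict f (set_rtree t)) t"
      by (auto intro: rtree.map_cong0)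
    moreover have "restrict f (set_rtree t) \<in> PiE (set_rtree t) L" using f(2) by auto
    ultimately show "z \<in> (\<lambda>f. map_rtree f t) ` (PiE (set_rtree t) L)" by blast
  qed
  then show ?thesis
    by (rule finite_subset) (simp add: assms finite_PiE)
qed

text \<open>This is the recursion behind the count. Once the root has colour \<open>c\<close>, a
  code amounts to a set of pairwise different branch codes, one from each child, whose roots avoid
  \<open>c\<close>. Conversely, colourings of the branches glue because their labels are
  disjoint.\<close>

lemma codes_RNode:
  assumes dl: "distinct_labels (RNode a M)" and c: "c \<in> L a"
  shows "{z \<in> codes L (RNode a M). root z = c} =
    (\<lambda>X. RNode c (mset_set X)) ` transversals (\<lambda>S. {z \<in> codes L S. root z \<noteq> c}) (set_mset M)"
    (is "?lhs = ?F ` ?T")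
proof
  show "?lhs \<subseteq> ?F ` ?T"
  proof
    fix z assume "z \<in> ?lhs"
    then obtain f where f: "z = map_rtree f (RNode a M)" "\<forall>v\<in>set_rtree (RNode a M). f v \<in> L v"
      "good_code (map_rtree f (RNode a M))" "f a = c"
      by (auto simp: codes_def)
    have uniq: "uniq_mset (image_mset (map_rtree f) M)" using f(3) by (simp add: good_code_RNode)
    then have "inj_on (map_rtree f) (set_mset M)" by (simp add: uniq_mset_image_iff)
    moreover have "map_rtree f S \<in> {z \<in> codes L S. root z \<noteq> c}" if "S \<in># M" for S
      using f(2-4) that by (auto simp: codes_def good_code_RNode)
    ultimately have "map_rtree f ` set_mset M \<in> ?T"
      unfolding transversals_def by blast
    moreover have "z = ?F (map_rtree f ` set_mset M)"
      using f(1,4) uniq by (simp add: uniq_mset_def)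
    ultimately show "z \<in> ?F ` ?T" by blast
  qed
  show "?F ` ?T \<subseteq> ?lhs"
  proof
    fix z assume "z \<in> ?F ` ?T"
    then obtain g where z: "z = RNode c (mset_set (g ` set_mset M))" and inj: "inj_on g (set_mset M)"
      and g: "\<And>S. S \<in># M \<Longrightarrow> g S \<in> codes L S \<and> root (g S) \<noteq> c"
      by (auto simp: transversals_def)
    \<comment> \<open>Each chosen code comes with a colouring realising it; \<open>F\<close> selects
      one per branch.\<close>
    have "\<forall>S. \<exists>f. S \<in># M \<longrightarrow> g S = map_rtree f S \<and> (\<forall>v\<in>set_rtree S. f v \<in> L v) \<and> good_code (g S)"
      using g by (fastforce simp: codes_def)
    then obtain F where F: "\<And>S. S \<in># M \<Longrightarrow> g S = map_rtree (F S) S"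
      "\<And>S v. S \<in># M \<Longrightarrow> v \<in> set_rtree S \<Longrightarrow> F S v \<in> L v" "\<And>S. S \<in># M \<Longrightarrow> good_code (g S)"
      by metis
    \<comment> \<open>Every vertex other than the root lies in exactly one branch and takes its
      colour from there.\<close>
    define f where "f v = (if v = a then c else F (THE S. S \<in># M \<and> v \<in> set_rtree S) v)" for v
    have fS: "f v = F S v" if "S \<in># M" "v \<in> set_rtree S" for S v
    proof -
      have "v \<noteq> a" using dl that by (auto simp: distinct_labels_RNode)
      moreover have "(THE S. S \<in># M \<and> v \<in> set_rtree S) = S"
        by (rule the_equality) (use that distinct_labels_child_eqI[OF dl] in blast)+
      ultimately show ?thesis by (simp add: f_def)
    qed
    have map: "map_rtree f S = g S" if "S \<in># M" for S
      unfolding F(1)[OF that] by (rule rtree.map_cong0) (simp add: fS that)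
    have "uniq_mset M" using dl by (simp add: distinct_labels_RNode)
    then have "image_mset g M = mset_set (g ` set_mset M)"
      using inj by (metis image_mset_mset_set uniq_mset_def)
    moreover have "image_mset (map_rtree f) M = image_mset g M"
      by (rule image_mset_cong) (rule map)
    ultimately have "map_rtree f (RNode a M) = z"
      using z by (simp add: f_def)
    moreover have "good_code z"
      unfolding z good_code_RNode using F(3) g by auto
    moreover have "\<forall>v\<in>set_rtree (RNode a M). f v \<in> L v"
      using fS F(2) c by (auto simp: f_def)
    ultimately show "z \<in> ?lhs" unfolding codes_def z by auto
  qed
qed

lemma card_codes_RNode:
  assumes "distinct_labels (RNode a M)" "c \<in> L a"
    and "\<And>v. v \<in> set_rtree (RNode a M) \<Longrightarrow> finite (L v)"
  shows "card {z \<in> codes L (RNode a M). root z = c} =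
    card (transversals (\<lambda>S. {z \<in> codes L S. root z \<noteq> c}) (set_mset M))"
proof -
  have "finite X" if "X \<in> transversals (\<lambda>S. {z \<in> codes L S. root z \<noteq> c}) (set_mset M)" for X
    using that by (auto simp: transversals_def)
  then have "inj_on (\<lambda>X. RNode c (mset_set X)) (transversals (\<lambda>S. {z \<in> codes L S. root z \<noteq> c}) (set_mset M))"
    by (auto intro!: inj_onI dest!: arg_cong[where f = set_mset])
  then show ?thesis
    unfolding codes_RNode[where L = L and a = a and c = c, OF assms(1,2)] by (rule card_image)
qed

lemma card_codes_root_neq:
  assumes "\<And>v. v \<in> set_rtree t \<Longrightarrow> finite (L v)"
  shows "card {z \<in> codes L t. root z \<noteq> c} =
    (\<Sum>d \<in> L (root t) - {c}. card {z \<in> codes L t. root z = d})"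
proof -
  have "{z \<in> codes L t. root z \<noteq> c} = (\<Union>d \<in> L (root t) - {c}. {z \<in> codes L t. root z = d})"
    using root_codes by blast
  then show ?thesis
    using assms finite_codes[of t L] by (simp, subst card_UN_disjoint) auto
qed

text \<open>\<open>map_rtree (\<lambda>_. ())\<close> is the unlabelled shape. Trees of equal shape
  are isomorphic by transport, and constant lists are unchanged along the isomorphism.\<close>

lemma codes_const_eq:
  fixes S S' :: "'a rtree"
  assumes "distinct_labels S" "distinct_labels S'" "map_rtree (\<lambda>_. ()) S = map_rtree (\<lambda>_. ()) S'"
  shows "codes (\<lambda>_. U) S = codes (\<lambda>_. U) S'"
proof -
  have sub: "codes (\<lambda>_. U) S \<subseteq> codes (\<lambda>_. U) S'"
    if dl: "distinct_labels S'" and eq: "map_rtree (\<lambda>_. ()) S' = map_rtree (\<lambda>_. ()) S" for S S' :: "'a rtree"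
  proof
    fix z assume "z \<in> codes (\<lambda>_. U) S"
    then obtain f where f: "z = map_rtree f S" "\<forall>v\<in>set_rtree S. f v \<in> U" "good_code z"
      by (auto simp: codes_def)
    obtain g where g: "map_rtree g S' = S"
      using map_rtree_eq_imp_transport[OF eq dl] by blast
    then have "z = map_rtree (f \<circ> g) S'" using f(1) by (auto simp: rtree.map_comp)
    moreover have "\<forall>v\<in>set_rtree S'. (f \<circ> g) v \<in> U"
      using f(2) g by (auto simp: rtree.set_map)
    ultimately show "z \<in> codes (\<lambda>_. U) S'"
      using f(3) unfolding codes_def by blast
  qed
  show ?thesis
    using sub[OF assms(2) assms(3)[symmetric]] sub[OF assms(1,3)] by (rule subset_antisym)
qed

text \<open>Applying the induction hypothesis also to the constant lists shows that, for constant
  lists, the number of codes does not depend on the colour of the root.\<close>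

lemma card_codes_const_le:
  fixes t :: "'a rtree" and L :: "'a \<Rightarrow> 'c set" and U :: "'c set"
  assumes "distinct_labels t" "finite U"
    and "\<And>v. v \<in> set_rtree t \<Longrightarrow> finite (L v) \<and> card U \<le> card (L v)"
    and "c \<in> L (root t)" "c' \<in> U"
  shows "card {z \<in> codes (\<lambda>_. U) t. root z = c'} \<le> card {z \<in> codes L t. root z = c}"
  using assms
proof (induction t arbitrary: L c c' rule: rtree.induct)
  case (RNode a M)
  let ?B = "\<lambda>S. {z \<in> codes (\<lambda>_. U) S. root z \<noteq> c'}" and ?A = "\<lambda>S. {z \<in> codes L S. root z \<noteq> c}"
  have dl: "distinct_labels S" if "S \<in># M" for S
    using RNode.prems(1) that by (simp add: distinct_labels_RNode)
  have L: "finite (L v)" "card U \<le> card (L v)" if "S \<in># M" "v \<in> set_rtree S" for S v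
    using RNode.prems(3)[of v] that by auto
  have "card (transversals ?B (set_mset M)) \<le> card (transversals ?A (set_mset M))"
  \<comment> \<open>Children are grouped by shape: constant lists give equal families within a
    shape, and families of different shapes are disjoint.\<close>
  proof (rule card_transversals_mono[where \<sigma> = "map_rtree (\<lambda>_. ())"])
    fix S assume S: "S \<in># M"
    show "finite (?A S)" "finite (?B S)"
      using finite_codes[of S L] L(1)[OF S] finite_codes[of S "\<lambda>_. U"] RNode.prems(2) by auto
    \<comment> \<open>\<open>n\<close> separates the two sides: for each root colour it bounds the
      count from above for the constant list and from below for \<open>L\<close>.\<close>
    define n where "n = card {z \<in> codes (\<lambda>_. U) S. root z = c'}"
    have nB: "card {z \<in> codes (\<lambda>_. U) S. root z = d} \<le> n" if "d \<in> U" for d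
      unfolding n_def using RNode.IH[where L = "\<lambda>_. U" and c = c' and c' = d, OF S dl[OF S]] RNode.prems(2,5) that
      by simp
    have nA: "n \<le> card {z \<in> codes L S. root z = d}" if "d \<in> L (root S)" for d
      unfolding n_def using RNode.IH[where L = L and c = d and c' = c', OF S dl[OF S]] RNode.prems(2,5) L[OF S] that
      by simp
    have "card (?B S) = (\<Sum>d \<in> U - {c'}. card {z \<in> codes (\<lambda>_. U) S. root z = d})"
      by (rule card_codes_root_neq) (rule RNode.prems(2))
    also have "\<dots> \<le> (\<Sum>d \<in> U - {c'}. n)"
      by (rule sum_mono) (simp add: nB)
    also have "\<dots> = card (U - {c'}) * n" by simp
    \<comment> \<open>\<open>c'\<close> lies in \<open>U\<close>, so removing it costs exactly one
      colour, whereas removing \<open>c\<close> from the list of the child costs at most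
      one.\<close>
    also have "\<dots> \<le> card (L (root S) - {c}) * n"
      using L[OF S root_in_set_rtree] RNode.prems(2,5)
      by (intro mult_le_mono1) (auto simp: card_Diff_singleton_if)
    also have "\<dots> = (\<Sum>d \<in> L (root S) - {c}. n)" by simp
    also have "\<dots> \<le> (\<Sum>d \<in> L (root S) - {c}. card {z \<in> codes L S. root z = d})"
      by (rule sum_mono) (simp add: nA)
    also have "\<dots> = card (?A S)"
      by (rule card_codes_root_neq[symmetric]) (rule L(1)[OF S])
    finally show "card (?B S) \<le> card (?A S)" .
  next
    fix S S' assume "S \<in># M" "S' \<in># M" "map_rtree (\<lambda>_. ()) S = map_rtree (\<lambda>_. ()) S'"
    then show "?B S = ?B S'" using codes_const_eq dl by blast
  next
    fix S S' :: "'a rtree" assume ne: "map_rtree (\<lambda>_. ()) S \<noteq> map_rtree (\<lambda>_. ()) S'"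
    \<comment> \<open>A code retains the shape of the tree that it colours.\<close>
    have sk: "map_rtree (\<lambda>_. ()) z = map_rtree (\<lambda>_. ()) R" if "z \<in> codes L R" for z R
      using that by (auto simp: codes_def rtree.map_comp comp_def)
    show "?A S \<inter> ?A S' = {}"
    proof (rule equals0I)
      fix z assume "z \<in> ?A S \<inter> ?A S'"
      then show False using sk[of z S] sk[of z S'] ne by simp
    qed
  qed simp
  then show ?case
    using RNode.prems by (simp add: card_codes_RNode del: rtree.set)
qed

text \<open>The colouring \<open>f\<close> makes the count for the constant list \<open>U\<close>
  positive, and the comparison carries this over to \<open>L\<close>.\<close>

lemma list_coloring_exists:
  fixes t :: "'a rtree" and L :: "'a \<Rightarrow> 'c set" and U :: "'c set"
  assumes "distinct_labels t" "finite U"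
    and "\<And>v. v \<in> set_rtree t \<Longrightarrow> finite (L v) \<and> card U \<le> card (L v)"
    and "\<And>v. v \<in> set_rtree t \<Longrightarrow> f v \<in> U" "good_code (map_rtree f t)"
  shows "\<exists>g. (\<forall>v\<in>set_rtree t. g v \<in> L v) \<and> good_code (map_rtree g t)"
proof -
  have U: "f (root t) \<in> U" using assms(4) by simp
  \<comment> \<open>\<open>U\<close> contains a colour, so the list of the root is nonempty too and
    offers some \<open>c\<close>.\<close>
  then have "card U > 0" using assms(2) by (auto simp: card_gt_0_iff)
  then obtain c where c: "c \<in> L (root t)"
    using assms(3)[of "root t"] by (fastforce simp: card_gt_0_iff)
  have "map_rtree f t \<in> {z \<in> codes (\<lambda>_. U) t. root z = f (root t)}"
    using assms(4,5) by (auto simp: codes_def)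
  then have "0 < card {z \<in> codes (\<lambda>_. U) t. root z = f (root t)}"
    using finite_codes[of t "\<lambda>_. U"] assms(2) by (auto simp: card_gt_0_iff)
  also have "\<dots> \<le> card {z \<in> codes L t. root z = c}"
    by (rule card_codes_const_le) (use assms c U in auto)
  finally have "codes L t \<noteq> {}" by (auto simp: card_gt_0_iff)
  then show ?thesis by (auto simp: codes_def)
qed

section \<open>Rooting a tree at an almost fixed vertex\<close>

text \<open>Walks must stay inside \<open>V\<close>, so this is connectivity of the subgraph induced
  by \<open>V\<close>.\<close>

definition conn_on :: "('a \<times> 'a) set \<Rightarrow> 'a set \<Rightarrow> bool" where
  "conn_on E V \<longleftrightarrow> (\<forall>u\<in>V. \<forall>v\<in>V. (u, v) \<in> (E \<inter> V \<times> V)\<^sup>*)"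

text \<open>An isolated vertex counts as a leaf, so a single vertex has one as well.\<close>

definition leaf_on :: "('a \<times> 'a) set \<Rightarrow> 'a set \<Rightarrow> 'a \<Rightarrow> bool" where
  "leaf_on E V w \<longleftrightarrow> w \<in> V \<and> (\<forall>a\<in>V. \<forall>b\<in>V. (w, a) \<in> E \<longrightarrow> (w, b) \<in> E \<longrightarrow> a = b)"

lemma leaf_onD: "leaf_on E V w \<Longrightarrow> (w, a) \<in> E \<Longrightarrow> (w, b) \<in> E \<Longrightarrow> a \<in> V \<Longrightarrow> b \<in> V \<Longrightarrow> a = b"
  by (auto simp: leaf_on_def)

text \<open>A walk enters and leaves a leaf through the same neighbour, so the detour can be cut
  out; this works for many leaves at once.\<close>

lemma conn_on_remove_leaves:
  assumes "conn_on E V" "sym E" and leaf: "\<And>w. w \<in> X \<Longrightarrow> leaf_on E V w"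
  shows "conn_on E (V - X)"
  unfolding conn_on_def
proof (intro ballI)
  fix u v assume uv: "u \<in> V - X" "v \<in> V - X"
  let ?E = "E \<inter> (V - X) \<times> (V - X)"
  have "(u, v) \<in> (E \<inter> V \<times> V)\<^sup>*"
    using assms(1) uv by (auto simp: conn_on_def)
  \<comment> \<open>The last conjunct covers a walk currently standing on a removed vertex: its
    neighbour in \<open>V\<close> survives and has been reached.\<close>
  then have "v \<in> V \<and> (v \<notin> X \<longrightarrow> (u, v) \<in> ?E\<^sup>*) \<and>
      (v \<in> X \<longrightarrow> (\<forall>n\<in>V. (v, n) \<in> E \<longrightarrow> n \<notin> X \<and> (u, n) \<in> ?E\<^sup>*))"
  proof (induction rule: rtrancl_induct)
    case base
    then show ?case using uv by auto
  next
    case (step v w)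
    then have vw: "v \<in> V" "w \<in> V" "(v, w) \<in> E" "(w, v) \<in> E"
      using \<open>sym E\<close> by (auto dest: symD)
    show ?case
    proof (cases "v \<in> X")
      case True
      then show ?thesis using step.IH vw by blast
    next
      case False
      then have v: "(u, v) \<in> ?E\<^sup>*" using step.IH by blast
      have "(u, w) \<in> ?E\<^sup>*" if "w \<notin> X"
        using v vw that False by (auto intro: rtrancl_into_rtrancl)
      moreover have "n = v" if "w \<in> X" "n \<in> V" "(w, n) \<in> E" for n
        using leaf_onD[OF leaf[OF that(1)] that(3) vw(4) that(2) vw(1)] .
      ultimately show ?thesis using v vw(2) False by auto
    qed
  qed
  then show "(u, v) \<in> ?E\<^sup>*" using uv by blast
qed

definition autom_on :: "('a \<times> 'a) set \<Rightarrow> 'a set \<Rightarrow> ('a \<Rightarrow> 'a) \<Rightarrow> bool" where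
  "autom_on E V \<phi> \<longleftrightarrow> bij_betw \<phi> V V \<and> (\<forall>u\<in>V. \<forall>v\<in>V. (u, v) \<in> E \<longleftrightarrow> (\<phi> u, \<phi> v) \<in> E)"

lemma leaf_on_autom_iff:
  assumes "autom_on E V \<phi>" "w \<in> V"
  shows "leaf_on E V (\<phi> w) \<longleftrightarrow> leaf_on E V w"
proof -
  have V: "\<phi> ` V = V" and inj: "inj_on \<phi> V"
    using assms(1) by (auto simp: autom_on_def bij_betw_def)
  have "leaf_on E (\<phi> ` V) (\<phi> w) \<longleftrightarrow>
      (\<forall>a\<in>V. \<forall>b\<in>V. (\<phi> w, \<phi> a) \<in> E \<longrightarrow> (\<phi> w, \<phi> b) \<in> E \<longrightarrow> \<phi> a = \<phi> b)"
    using assms(2) by (simp add: leaf_on_def)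
  also have "\<dots> \<longleftrightarrow> leaf_on E V w"
    using assms inj by (auto simp: leaf_on_def autom_on_def inj_on_eq_iff)
  finally show ?thesis unfolding V .
qed

text \<open>Automorphisms permute the leaves, so they restrict to what is left when all leaves are
  removed together.\<close>

lemma autom_on_nonleaves:
  assumes "autom_on E V \<phi>"
  shows "autom_on E (V - Collect (leaf_on E V)) \<phi>"
proof -
  let ?L = "Collect (leaf_on E V)"
  have V: "\<phi> ` V = V" and inj: "inj_on \<phi> V"
    using assms by (auto simp: autom_on_def bij_betw_def)
  have "\<phi> ` (V - ?L) = V - ?L"
  proof
    show "\<phi> ` (V - ?L) \<subseteq> V - ?L"
      using V leaf_on_autom_iff[OF assms] by auto
    show "V - ?L \<subseteq> \<phi> ` (V - ?L)"
    proof
      fix y assume y: "y \<in> V - ?L"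
      then obtain x where "x \<in> V" "y = \<phi> x" using V by blast
      then show "y \<in> \<phi> ` (V - ?L)" using y leaf_on_autom_iff[OF assms] by auto
    qed
  qed
  moreover have "inj_on \<phi> (V - ?L)" by (rule inj_on_subset[OF inj]) auto
  ultimately show ?thesis using assms by (simp add: autom_on_def bij_betw_def)
qed

text \<open>All leaves are removed in each round until every remaining vertex is a leaf;
  connectivity then leaves one vertex or two adjacent ones. The assumption on subsets
  \<open>W\<close> expresses acyclicity and makes every round remove something.\<close>

lemma exists_almost_fixed_vertex:
  assumes "finite V" "V \<noteq> {}" "sym E" "conn_on E V"
    and "\<And>W. W \<subseteq> V \<Longrightarrow> W \<noteq> {} \<Longrightarrow> \<exists>w. leaf_on E W w"
  shows "\<exists>x\<in>V. \<forall>\<phi>. autom_on E V \<phi> \<longrightarrow> \<phi> x = x \<or> (x, \<phi> x) \<in> E"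
  using assms
proof (induction V rule: finite_psubset_induct)
  case (psubset V)
  let ?L = "Collect (leaf_on E V)"
  show ?case
  proof (cases "V \<subseteq> ?L")
    case True
    obtain x where x: "x \<in> V" using psubset.prems(1) by blast
    have "y = x \<or> (x, y) \<in> E" if "y \<in> V" for y
    proof -
      have "(x, y) \<in> (E \<inter> V \<times> V)\<^sup>*" using psubset.prems(3) x that by (simp add: conn_on_def)
      then show ?thesis
      proof (induction rule: rtrancl_induct)
        case (step y z)
        show ?case
        proof (cases "y = x")
          \<comment> \<open>The walk is at a neighbour \<open>y\<close> of \<open>x\<close>; being a
            leaf, \<open>y\<close> allows a step only back to \<open>x\<close>.\<close>
          case False
          then have "(y, x) \<in> E" using step.IH \<open>sym E\<close> by (auto dest: symD)
          moreover have "leaf_on E V y" using step.hyps(2) True by auto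
          ultimately show ?thesis using leaf_onD[of E V y x z] x step.hyps(2) by auto
        qed (use step in auto)
      qed simp
    qed
    then show ?thesis
      using x by (metis autom_on_def bij_betwE)
  next
    case False
    have "V - ?L \<subset> V" using psubset.prems(4)[of V] psubset.prems(1) by (auto simp: leaf_on_def)
    moreover have "conn_on E (V - ?L)"
      by (rule conn_on_remove_leaves) (use psubset.prems in auto)
    ultimately have "\<exists>x\<in>V - ?L. \<forall>\<phi>. autom_on E (V - ?L) \<phi> \<longrightarrow> \<phi> x = x \<or> (x, \<phi> x) \<in> E"
      using False psubset.prems(4) by (intro psubset.IH \<open>sym E\<close>) auto
    then show ?thesis using autom_on_nonleaves by blast
  qed
qed

section \<open>Existence of rooted representations\<close>

definition represents :: "'a rtree \<Rightarrow> ('a \<times> 'a) set \<Rightarrow> 'a set \<Rightarrow> bool" where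
  "represents t E V \<longleftrightarrow>
     distinct_labels t \<and> set_rtree t = V \<and> uedges t = E \<inter> V \<times> V"

text \<open>This undoes the stripping of a leaf \<open>w\<close> with neighbour
  \<open>u\<close>.\<close>

primrec graft :: "'a \<Rightarrow> 'a \<Rightarrow> 'a rtree \<Rightarrow> 'a rtree" where
  "graft u w (RNode a M) =
     RNode a (image_mset (graft u w) M + (if a = u then {#RNode w {#}#} else {#}))"

lemma root_graft [simp]: "root (graft u w t) = root t"
  by (cases t) simp

lemma set_graft: "set_rtree (graft u w t) = set_rtree t \<union> (if u \<in> set_rtree t then {w} else {})"
  by (induction t) (auto split: if_splits)

lemma edges_graft: "edges (graft u w t) = edges t \<union> (if u \<in> set_rtree t then {(u, w)} else {})"
  by (induction t) (auto simp: image_image split: if_splits)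

lemma distinct_labels_graft:
  "distinct_labels t \<Longrightarrow> w \<notin> set_rtree t \<Longrightarrow> distinct_labels (graft u w t)"
proof (induction t)
  case (RNode a M)
  note dl = distinct_labels_child_eqI[OF RNode.prems(1)]
  have aM: "a \<notin> set_rtree S" "distinct_labels S" if "S \<in># M" for S
    using RNode.prems(1) that by (auto simp: distinct_labels_RNode)
  have wM: "w \<notin> set_rtree S" if "S \<in># M" for S using RNode.prems(2) that by auto
  have wa: "w \<noteq> a" using RNode.prems(2) by auto
  have inj: "inj_on (graft u w) (set_mset M)"
    by (rule inj_onI) (metis dl root_graft root_in_set_rtree)
  have uniq: "uniq_mset (image_mset (graft u w) M)"
    using RNode.prems(1) inj by (simp add: distinct_labels_RNode uniq_mset_image_iff)
  have disj: "graft u w S = graft u w S'"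
    if "S \<in># M" "S' \<in># M" "v \<in> set_rtree (graft u w S)" "v \<in> set_rtree (graft u w S')" for S S' v
    using that wM dl by (auto simp: set_graft split: if_splits)
  have base: "distinct_labels (RNode a (image_mset (graft u w) M))"
  proof (rule distinct_labels.intros[OF _ _ uniq])
    fix S assume "S \<in># image_mset (graft u w) M"
    then show "distinct_labels S" "a \<notin> set_rtree S"
      using RNode.IH aM wM wa by (auto simp: set_graft split: if_splits)
  next
    fix S S' assume "S \<in># image_mset (graft u w) M" "S' \<in># image_mset (graft u w) M" "S \<noteq> S'"
    then show "set_rtree S \<inter> set_rtree S' = {}" using disj by auto
  qed
  show ?case
  proof (cases "a = u")
    case True
    \<comment> \<open>The node is \<open>u\<close> itself, so \<open>u\<close> lies in no branch and
      none of the branches has received \<open>w\<close>.\<close>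
    have w: "w \<notin> set_rtree S" if "S \<in># image_mset (graft u w) M" for S
      using that wM aM True by (auto simp: set_graft split: if_splits)
    then have "RNode w {#} \<notin># image_mset (graft u w) M"
      by (metis rtree.set_intros(1))
    then have "uniq_mset (add_mset (RNode w {#}) (image_mset (graft u w) M))"
      using uniq by (simp add: uniq_mset_add_iff)
    moreover have "distinct_labels (RNode w {#})"
      by (simp add: distinct_labels_RNode uniq_mset_def)
    ultimately show ?thesis
      using base w wa True by (simp add: distinct_labels_RNode)
  qed (use base in simp)
qed

text \<open>A leaf \<open>w\<close> is stripped and later restored: below its neighbour
  \<open>u\<close> if the root is another vertex, or as the new root above a representation rooted
  at \<open>u\<close>. The root is kept arbitrary for the second case.\<close>

lemma exists_representation:
  assumes "finite V" "sym E" "irrefl E" "conn_on E V"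
    and "\<And>W. W \<subseteq> V \<Longrightarrow> W \<noteq> {} \<Longrightarrow> \<exists>w. leaf_on E W w"
    and "x \<in> V"
  shows "\<exists>t. represents t E V \<and> root t = x"
  using assms
proof (induction V arbitrary: x rule: finite_psubset_induct)
  case (psubset V)
  obtain w where w: "leaf_on E V w" using psubset.prems(4)[of V] psubset.prems(5) by blast
  then have wV: "w \<in> V" by (simp add: leaf_on_def)
  show ?case
  proof (cases "V = {w}")
    case True
    then have "represents (RNode w {#}) E V"
      using \<open>irrefl E\<close> by (auto simp: represents_def distinct_labels_RNode uniq_mset_def irrefl_def)
    then show ?thesis using True psubset.prems(5) by force
  next
    case False
    then obtain v where v: "v \<in> V" "v \<noteq> w" using wV by blast
    have "(w, v) \<in> (E \<inter> V \<times> V)\<^sup>*" using psubset.prems(3) v wV by (simp add: conn_on_def)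
    then obtain u where u: "(w, u) \<in> E" "u \<in> V"
      using v(2) by (cases rule: converse_rtranclE) auto
    have uw: "u \<noteq> w" using u(1) \<open>irrefl E\<close> by (auto simp: irrefl_def)
    have uwE: "(u, w) \<in> E" using u(1) \<open>sym E\<close> by (auto dest: symD)
    let ?V = "V - {w}"
    have IH: "\<exists>t. represents t E ?V \<and> root t = y" if "y \<in> ?V" for y
    proof (rule psubset.IH)
      show "conn_on E ?V"
        by (rule conn_on_remove_leaves[OF psubset.prems(3,1)]) (use w in auto)
      show "\<exists>z. leaf_on E W z" if "W \<subseteq> ?V" "W \<noteq> {}" for W
        using psubset.prems(4)[of W] that by blast
    qed (use psubset.prems wV that in auto)
    \<comment> \<open>The only edge at the leaf \<open>w\<close> joins it to
      \<open>u\<close>.\<close>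
    have E: "E \<inter> V \<times> V = E \<inter> ?V \<times> ?V \<union> {(u, w), (w, u)}"
    proof -
      have "a = u" if "(w, a) \<in> E" "a \<in> V" for a
        using leaf_onD[OF w that(1) u(1) that(2) u(2)] .
      moreover have "a = u" if "(a, w) \<in> E" "a \<in> V" for a
        using calculation[of a] that \<open>sym E\<close> by (auto dest: symD)
      ultimately show ?thesis using u uwE wV by blast
    qed
    show ?thesis
    proof (cases "x = w")
      case True
      obtain t where t: "represents t E ?V" "root t = u" using IH[of u] u uw by blast
      have "represents (RNode w {#t#}) E V"
        using t E wV by (auto simp: represents_def distinct_labels_RNode uniq_mset_def)
      then show ?thesis using True by force
    next
      case False
      obtain t where t: "represents t E ?V" "root t = x" using IH[of x] psubset.prems(5) False by blast
      have "set_rtree (graft u w t) = V"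
        using t(1) u(2) uw wV by (auto simp: represents_def set_graft)
      moreover have "distinct_labels (graft u w t)"
        using t(1) by (auto simp: represents_def intro!: distinct_labels_graft)
      moreover have "uedges (graft u w t) = E \<inter> V \<times> V"
      proof -
        have "edges (graft u w t) = insert (u, w) (edges t)"
          using t(1) u(2) uw by (simp add: edges_graft represents_def)
        then have "uedges (graft u w t) =
            uedges t \<union> {(u, w), (w, u)}" by auto
        then show ?thesis using t(1) E by (simp only: represents_def)
      qed
      ultimately show ?thesis using t(2) by (auto simp: represents_def)
    qed
  qed
qed

section \<open>Uniqueness of the representation, and automorphisms\<close>

lemma root_reaches: "v \<in> set_rtree t \<Longrightarrow> (root t, v) \<in> (edges t)\<^sup>*"
proof (induction t)
  case (RNode a M)
  show ?case
  proof (cases "v = a")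
    case False
    then obtain S where S: "S \<in># M" "v \<in> set_rtree S" using RNode.prems by auto
    have "(edges S)\<^sup>* \<subseteq> (edges (RNode a M))\<^sup>*" using S(1) by (intro rtrancl_mono) auto
    then have "(root S, v) \<in> (edges (RNode a M))\<^sup>*" using RNode.IH[OF S] by blast
    moreover have "(a, root S) \<in> edges (RNode a M)" using S(1) by auto
    ultimately show ?thesis by (simp add: converse_rtrancl_into_rtrancl)
  qed simp
qed

text \<open>An edge of another branch has both ends there, away from the vertices of
  \<open>S\<close>, and the remaining edges touch \<open>a\<close>.\<close>

lemma uedges_child:
  assumes "distinct_labels (RNode a M)" "S \<in># M"
  shows "uedges S = uedges (RNode a M) \<inter> set_rtree S \<times> set_rtree S"
proof -
  have "a \<notin> set_rtree S" using assms by (simp add: distinct_labels_RNode)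
  moreover have "R = S" if "(x, y) \<in> edges R" "R \<in># M" "x \<in> set_rtree S" for R x y
    using distinct_labels_child_eqI[OF assms(1) that(2) assms(2) _ that(3)] edges_subset[of R] that(1)
    by blast
  ultimately show ?thesis
    using edges_subset[of S] assms(2) by (auto simp: image_iff)
qed

text \<open>The root of \<open>S\<close> is adjacent to \<open>a\<close>, hence also the root of a
  branch of \<open>N\<close>. Walks inside \<open>S\<close> avoid \<open>a\<close>, and without
  \<open>a\<close> no edge leaves that branch.\<close>

lemma child_set_subset:
  assumes M: "distinct_labels (RNode a M)" and N: "distinct_labels (RNode a N)"
    and eq: "uedges (RNode a M) = uedges (RNode a N)" and S: "S \<in># M"
  shows "\<exists>S'\<in>#N. root S' = root S \<and> set_rtree S \<subseteq> set_rtree S'"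
proof -
  have aM: "a \<notin> set_rtree S" using M S by (simp add: distinct_labels_RNode)
  have aN: "a \<notin> set_rtree R" if "R \<in># N" for R using N that by (simp add: distinct_labels_RNode)
  have "(a, root S) \<in> uedges (RNode a N)" unfolding eq[symmetric] using S by auto
  then obtain S' where S': "S' \<in># N" "root S' = root S"
    using aN edges_subset aM root_in_set_rtree[of S] by fastforce
  have "v \<in> set_rtree S'" if "v \<in> set_rtree S" for v
  proof -
    have "(root S, v) \<in> (edges S)\<^sup>*" by (rule root_reaches[OF that])
    then show ?thesis
    proof (induction rule: rtrancl_induct)
      case base
      then show ?case using S'(2) root_in_set_rtree[of S'] by simp
    next
      case (step v w)
      have "w \<noteq> a" using step.hyps(2) edges_subset[of S] aM by auto
      moreover have "v \<noteq> a" using step.IH aN[OF S'(1)] by auto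
      moreover have "(v, w) \<in> uedges (RNode a N)"
        unfolding eq[symmetric] using step.hyps(2) S by auto
      ultimately obtain R where R: "R \<in># N" "(v, w) \<in> edges R \<or> (w, v) \<in> edges R" by auto
      then have "v \<in> set_rtree R" "w \<in> set_rtree R" using edges_subset[of R] by auto
      then show ?case
        using distinct_labels_child_eqI[OF N R(1) S'(1) _ step.IH] by blast
    qed
  qed
  then show ?thesis using S' by blast
qed

text \<open>A root orients all edges of a tree. Applied in both directions,
  \<open>child_set_subset\<close> matches branches by their roots and gives them equal vertex sets,
  hence equal edges.\<close>

lemma rtree_eq_if_uedges_eq:
  assumes "distinct_labels t" "distinct_labels t'" "root t = root t'" "uedges t = uedges t'"
  shows "t = t'"
  using assms
proof (induction t arbitrary: t' rule: rtree.induct)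
  case (RNode a M)
  obtain N where t': "t' = RNode a N" using RNode.prems(3) by (cases t') auto
  note dM = RNode.prems(1) and dN = RNode.prems(2)[unfolded t'] and eq = RNode.prems(4)[unfolded t']
  have rootM: "S = S'" if "S \<in># M" "S' \<in># M" "root S = root S'" for S S'
    using distinct_labels_child_eqI[OF dM that(1,2)] that(3) by (metis root_in_set_rtree)
  have rootN: "S = S'" if "S \<in># N" "S' \<in># N" "root S = root S'" for S S'
    using distinct_labels_child_eqI[OF dN that(1,2)] that(3) by (metis root_in_set_rtree)
  have MN: "S \<in># N" if S: "S \<in># M" for S
  proof -
    obtain S' where S': "S' \<in># N" "root S' = root S" "set_rtree S \<subseteq> set_rtree S'"
      using child_set_subset[OF dM dN eq S] by blast
    obtain S2 where S2: "S2 \<in># M" "root S2 = root S'" "set_rtree S' \<subseteq> set_rtree S2"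
      using child_set_subset[OF dN dM eq[symmetric] S'(1)] by blast
    have "S2 = S" by (rule rootM[OF S2(1) S]) (simp only: S2(2) S'(2))
    then have set: "set_rtree S' = set_rtree S"
      using S2(3) S'(3) by blast
    have "uedges S = uedges S'"
      unfolding uedges_child[OF dM S] uedges_child[OF dN S'(1)] eq set ..
    then have "S = S'"
      using RNode.IH[OF S, of S'] dM dN S S'(1,2) by (simp add: distinct_labels_RNode)
    then show ?thesis using S'(1) by simp
  qed
  have "S' \<in># M" if S': "S' \<in># N" for S'
  proof -
    obtain S where S: "S \<in># M" "root S = root S'"
      using child_set_subset[OF dN dM eq[symmetric] S'] by blast
    then have "S = S'" using rootN[OF MN S'] by blast
    then show ?thesis using S(1) by simp
  qed
  then have "M = N"
    using MN dM dN by (intro uniq_mset_eqI) (auto simp: distinct_labels_RNode)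
  then show ?case using t' by simp
qed

text \<open>The image tree has the same root and the same undirected edges, so uniqueness identifies
  it with \<open>t\<close>.\<close>

lemma map_rtree_autom:
  assumes "represents t E V" "autom_on E V \<phi>" "\<phi> (root t) = root t"
  shows "map_rtree \<phi> t = t"
proof (rule rtree_eq_if_uedges_eq)
  have t: "distinct_labels t" "set_rtree t = V" "uedges t = E \<inter> V \<times> V"
    using assms(1) by (auto simp: represents_def)
  have \<phi>: "\<phi> ` V = V" "inj_on \<phi> V" "\<And>u v. u \<in> V \<Longrightarrow> v \<in> V \<Longrightarrow> (u, v) \<in> E \<longleftrightarrow> (\<phi> u, \<phi> v) \<in> E"
    using assms(2) by (auto simp: autom_on_def bij_betw_def)
  show "distinct_labels (map_rtree \<phi> t)" using t \<phi> by (simp add: distinct_labels_map)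
  show "distinct_labels t" "root (map_rtree \<phi> t) = root t" using t assms(3) by auto
  have "uedges (map_rtree \<phi> t) = map_prod \<phi> \<phi> ` uedges t" by (rule uedges_map_rtree)
  also have "\<dots> = E \<inter> V \<times> V"
  proof
    show "map_prod \<phi> \<phi> ` uedges t \<subseteq> E \<inter> V \<times> V" unfolding t(3) using \<phi> by auto
    show "E \<inter> V \<times> V \<subseteq> map_prod \<phi> \<phi> ` uedges t"
    proof clarify
      fix x y assume xy: "(x, y) \<in> E" "x \<in> V" "y \<in> V"
      then have "x \<in> \<phi> ` V" "y \<in> \<phi> ` V" by (simp_all only: \<phi>(1))
      then obtain u v where "u \<in> V" "v \<in> V" "x = \<phi> u" "y = \<phi> v" by blast
      then show "(x, y) \<in> map_prod \<phi> \<phi> ` uedges t"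
        unfolding t(3) using xy \<phi>(3) by auto
    qed
  qed
  finally show "uedges (map_rtree \<phi> t) = uedges t" using t(3) by simp
qed

text \<open>Fixing \<open>t\<close> makes \<open>\<phi>\<close> map the finite set \<open>V\<close>
  onto itself, hence bijectively, and the edge set onto itself; injectivity then reflects
  edges.\<close>

lemma autom_on_if_map_rtree_fixed:
  assumes "represents t E V" "map_rtree \<phi> t = t"
  shows "autom_on E V \<phi>"
proof -
  have t: "set_rtree t = V" "uedges t = E \<inter> V \<times> V"
    using assms(1) by (auto simp: represents_def)
  have surj: "\<phi> ` V = V" using assms(2) t(1) by (metis rtree.set_map)
  have "finite V" using t(1) finite_set_rtree by blast
  then have inj: "inj_on \<phi> V" using surj by (simp add: finite_surj_inj)
  have img: "map_prod \<phi> \<phi> ` uedges t = uedges t"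
    using uedges_map_rtree[of \<phi> t] assms(2) by simp
  have "(u, v) \<in> E \<longleftrightarrow> (\<phi> u, \<phi> v) \<in> E" if "u \<in> V" "v \<in> V" for u v
  proof
    assume "(u, v) \<in> E"
    then have "(u, v) \<in> uedges t" using t(2) that by auto
    then have "(\<phi> u, \<phi> v) \<in> uedges t" using img by blast
    then show "(\<phi> u, \<phi> v) \<in> E" using t(2) by auto
  next
    assume "(\<phi> u, \<phi> v) \<in> E"
    then have "(\<phi> u, \<phi> v) \<in> map_prod \<phi> \<phi> ` uedges t" using t(2) surj that img by blast
    then obtain u' v' where "(u', v') \<in> uedges t" "\<phi> u = \<phi> u'" "\<phi> v = \<phi> v'" by auto
    then show "(u, v) \<in> E" using t(2) inj that by (auto dest: inj_onD)
  qed
  then show ?thesis using surj inj by (simp add: autom_on_def bij_betw_def)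
qed

section \<open>From undirected trees to leaves, connectivity and codes\<close>

lemma pcas_vwalk_arcs:
  "xs \<noteq> [] \<Longrightarrow> pcas (hd xs) (vwalk_arcs xs) (last xs)"
  by (induction xs rule: vwalk_arcs.induct) auto

lemma pawalk_verts_vwalk_arcs:
  "xs \<noteq> [] \<Longrightarrow> pawalk_verts (hd xs) (vwalk_arcs xs) = xs"
  by (induction xs rule: vwalk_arcs.induct) auto

text \<open>Otherwise the first vertex \<open>v\<close> of a longest path in \<open>W\<close> has
  two neighbours in \<open>W\<close>. By maximality both lie on the path, and one that is not the
  second vertex closes a cycle.\<close>

lemma undirected_tree_has_leaf:
  assumes T: "undirected_tree T" and W: "W \<subseteq> pverts T" "W \<noteq> {}"
  shows "\<exists>w. leaf_on (parcs T) W w"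
proof (rule ccontr)
  assume no_leaf: "\<nexists>w. leaf_on (parcs T) W w"
  interpret pair_graph T using T by (simp add: undirected_tree_def)
  let ?path = "\<lambda>p. p \<noteq> [] \<and> distinct p \<and> set p \<subseteq> W \<and> set (vwalk_arcs p) \<subseteq> parcs T"
  have "finite W" using W(1) pair_finite_verts by (rule finite_subset)
  obtain w where "w \<in> W" using W(2) by blast
  then have "?path [w]" by simp
  moreover have "\<forall>p. ?path p \<longrightarrow> length p < Suc (card W)"
    using \<open>finite W\<close> by (metis card_mono distinct_card less_Suc_eq_le)
  ultimately obtain p where p: "?path p" and max: "\<And>q. ?path q \<Longrightarrow> length q \<le> length p"
    using ex_has_greatest_nat[of ?path "[w]" length "Suc (card W)"] by blast
  obtain v q where vq: "p = v # q" using p by (cases p) auto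
  have "v \<in> W" using p vq by simp
  then obtain a b where ab: "a \<in> W" "b \<in> W" "(v, a) \<in> parcs T" "(v, b) \<in> parcs T" "a \<noteq> b"
    using no_leaf by (auto simp: leaf_on_def)
  have sym: "(y, x) \<in> parcs T" if "(x, y) \<in> parcs T" for x y
    using that pair_sym_arcs by (auto simp: symmetric_def dest: symD)
  have in_q: "x \<in> set q" if "x \<in> W" "(v, x) \<in> parcs T" for x
  proof (rule ccontr)
    assume "x \<notin> set q"
    moreover have "x \<noteq> v" using pair_no_loops[OF that(2)] by auto
    ultimately have "?path (x # p)" using p vq that sym by auto
    then show False using max[of "x # p"] by simp
  qed
  obtain c where c: "c \<in> set q" "c \<noteq> hd q" "(v, c) \<in> parcs T"
    using ab in_q by metis
  obtain q1 q2 where q: "q = q1 @ c # q2" using c(1) by (meson split_list)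
  have "q1 \<noteq> []" using c(2) q by auto
  \<comment> \<open>The cycle steps from \<open>c\<close> to \<open>v\<close> and follows the path
    back to \<open>c\<close>; since \<open>q1\<close> is nonempty, it has at least three
    arcs.\<close>
  let ?xs = "c # v # q1 @ [c]"
  have "p = (v # q1 @ [c]) @ q2" by (simp add: vq q)
  then have "set (vwalk_arcs (v # q1 @ [c])) \<subseteq> parcs T"
    using p set_vwalk_arcs_append1[of "v # q1 @ [c]" q2] by blast
  then have "set (vwalk_arcs ?xs) \<subseteq> parcs T" using sym[OF c(3)] by simp
  moreover have "c \<in> pverts T" using c(3) in_arcsD2 by blast
  moreover have "distinct (tl ?xs)" using p by (auto simp: vq q)
  ultimately have "cycle (vwalk_arcs ?xs)"
    using pcas_vwalk_arcs[of ?xs] pawalk_verts_vwalk_arcs[of ?xs]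
    unfolding cycle_def awalk_def by (intro exI[of _ c]) auto
  moreover have "3 \<le> length (vwalk_arcs ?xs)"
    using \<open>q1 \<noteq> []\<close> vwalk_length_simp[of ?xs] by (cases q1) (auto simp: vwalk_length_def)
  ultimately show False using T by (auto simp: undirected_tree_def)
qed

text \<open>With symmetric arcs, connectivity is strong connectivity, which includes that there is a
  vertex.\<close>

lemma undirected_tree_conn_on:
  assumes "undirected_tree T"
  shows "pverts T \<noteq> {}" "conn_on (parcs T) (pverts T)"
proof -
  interpret pair_graph T using assms by (simp add: undirected_tree_def)
  have sc: "strongly_connected (with_proj T)"
    using assms pair_sym_arcs
    by (intro symmetric_connected_imp_strongly_connected) (auto simp: undirected_tree_def)
  then show "pverts T \<noteq> {}" by (auto simp: strongly_connected_def)
  have "parcs T \<inter> pverts T \<times> pverts T = parcs T" using in_arcsD1 in_arcsD2 by auto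
  then show "conn_on (parcs T) (pverts T)"
    using sc reachable_rtranclI[of "with_proj T"] by (simp add: conn_on_def strongly_connected_def)
qed

lemma graph_automorphism_iff_autom_on:
  "graph_automorphism T \<phi> \<longleftrightarrow> autom_on (parcs T) (pverts T) \<phi>"
  by (simp add: graph_automorphism_def autom_on_def)

text \<open>Colour-preserving automorphisms of a proper colouring fix the root, which would
  otherwise go to a neighbour of the same colour. They are then symmetries of the rooted tree, where
  asymmetry means distinct siblings.\<close>

lemma proper_distinguishing_iff_good_code:
  assumes T: "pair_graph T" and t: "represents t (parcs T) (pverts T)"
    and root: "\<forall>\<phi>. autom_on (parcs T) (pverts T) \<phi> \<longrightarrow> \<phi> (root t) = root t \<or> (root t, \<phi> (root t)) \<in> parcs T"
  shows "proper_coloring T f \<and> distinguishing_coloring T f \<longleftrightarrow> good_code (map_rtree f t)"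
proof -
  interpret pair_graph T by fact
  have E: "parcs T \<inter> pverts T \<times> pverts T = parcs T" using in_arcsD1 in_arcsD2 by auto
  have t': "distinct_labels t" "set_rtree t = pverts T" "uedges t = parcs T"
    using t unfolding represents_def E by auto
  have proper: "proper_coloring T f \<longleftrightarrow> (\<forall>(u, v)\<in>edges (map_rtree f t). u \<noteq> v)"
    unfolding proper_coloring_def t'(3)[symmetric] edges_map_rtree by fastforce
  have "distinguishing_coloring T f \<longleftrightarrow> distinct_siblings (map_rtree f t)" if pr: "proper_coloring T f"
  proof
    assume d: "distinguishing_coloring T f"
    show "distinct_siblings (map_rtree f t)"
    proof (rule ccontr)
      assume "\<not> ?thesis"
      then obtain \<phi> where "map_rtree \<phi> t = t" "\<forall>v\<in>set_rtree t. f (\<phi> v) = f v"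
        "\<exists>v\<in>set_rtree t. \<phi> v \<noteq> v"
        using not_distinct_siblings_imp_symmetry[OF t'(1)] by blast
      moreover from this(1) have "autom_on (parcs T) (pverts T) \<phi>"
        by (rule autom_on_if_map_rtree_fixed[OF t])
      ultimately show False
        using d unfolding distinguishing_coloring_def graph_automorphism_iff_autom_on t'(2) by blast
    qed
  next
    assume ds: "distinct_siblings (map_rtree f t)"
    have "\<phi> v = v" if \<phi>: "autom_on (parcs T) (pverts T) \<phi>" and v: "v \<in> pverts T"
      and f: "\<forall>v\<in>pverts T. f (\<phi> v) = f v" for \<phi> v
    proof -
      have "f (\<phi> (root t)) = f (root t)" using f t'(2) root_in_set_rtree[of t] by auto
      then have "(root t, \<phi> (root t)) \<notin> parcs T" using pr by (auto simp: proper_coloring_def)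
      then have "\<phi> (root t) = root t" using root \<phi> by blast
      then have "map_rtree \<phi> t = t" by (rule map_rtree_autom[OF t \<phi>])
      then show ?thesis using map_rtree_fixed_imp_id[OF ds] f v t'(2) by blast
    qed
    then show "distinguishing_coloring T f"
      by (auto simp: distinguishing_coloring_def graph_automorphism_iff_autom_on)
  qed
  then show ?thesis using proper by (auto simp: good_code_def)
qed

lemma undirected_tree_obtains_root:
  assumes T: "undirected_tree T"
  obtains t where "represents t (parcs T) (pverts T)"
    "\<forall>\<phi>. autom_on (parcs T) (pverts T) \<phi> \<longrightarrow> \<phi> (root t) = root t \<or> (root t, \<phi> (root t)) \<in> parcs T"
proof -
  interpret pair_graph T using T by (simp add: undirected_tree_def)
  have E: "sym (parcs T)" "irrefl (parcs T)"
    using pair_sym_arcs pair_no_loops by (force simp: symmetric_def irrefl_def)+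
  note conn = undirected_tree_conn_on[OF T] and leaf = undirected_tree_has_leaf[OF T]
  obtain x where x: "x \<in> pverts T"
    "\<forall>\<phi>. autom_on (parcs T) (pverts T) \<phi> \<longrightarrow> \<phi> x = x \<or> (x, \<phi> x) \<in> parcs T"
    using exists_almost_fixed_vertex[OF pair_finite_verts conn(1) E(1) conn(2) leaf] by blast
  obtain t where "represents t (parcs T) (pverts T)" "root t = x"
    using exists_representation[OF pair_finite_verts E conn(2) leaf x(1)] by blast
  then show ?thesis using that x(2) by blast
qed

section \<open>The two inequalities between the chromatic numbers\<close>

theorem theorem7:
  fixes T :: "'a pair_pre_digraph"
  assumes "undirected_tree T"
  shows "\<chi>\<^sub>D T = \<chi>\<^sub>D\<^sub>l T"
proof (rule antisym)
  have G: "pair_graph T" using assms by (simp add: undirected_tree_def)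
  \<comment> \<open>Constant lists of this size turn a list colouring into an ordinary one with at
    most that many colours.\<close>
  have "properly_list_distinguishable T (\<lambda>_. {..<\<chi>\<^sub>D\<^sub>l T})"
    using list_distinguishing_chromatic_number_attained[OF G] by simp
  then obtain f where f: "proper_coloring T f" "distinguishing_coloring T f" "f ` pverts T \<subseteq> {..<\<chi>\<^sub>D\<^sub>l T}"
    unfolding properly_list_distinguishable_def by blast
  have "\<chi>\<^sub>D T \<le> card (f ` pverts T)"
    unfolding distinguishing_chromatic_number_def by (rule Least_le) (use f in blast)
  also have "\<dots> \<le> \<chi>\<^sub>D\<^sub>l T" using card_mono[OF _ f(3)] by simp
  finally show "\<chi>\<^sub>D T \<le> \<chi>\<^sub>D\<^sub>l T" .
next
  have G: "pair_graph T" using assms by (simp add: undirected_tree_def)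
  interpret pair_graph T by (rule G)
  obtain t where t: "represents t (parcs T) (pverts T)" and
    root: "\<forall>\<phi>. autom_on (parcs T) (pverts T) \<phi> \<longrightarrow> \<phi> (root t) = root t \<or> (root t, \<phi> (root t)) \<in> parcs T"
    by (rule undirected_tree_obtains_root[OF assms])
  from t have V: "distinct_labels t" "set_rtree t = pverts T" by (auto simp: represents_def)
  \<comment> \<open>The colours used by an optimal colouring serve as the common list, of size
    \<open>\<chi>\<^sub>D T\<close>.\<close>
  obtain f :: "'a \<Rightarrow> nat" where f: "good_code (map_rtree f t)" "card (f ` pverts T) = \<chi>\<^sub>D T"
    using distinguishing_chromatic_number_attained[OF G]
      proper_distinguishing_iff_good_code[OF G t root] by blast
  have "properly_list_distinguishable T L"
    if L: "\<forall>v\<in>pverts T. infinite (L v) \<or> \<chi>\<^sub>D T \<le> card (L v)" for L :: "'a \<Rightarrow> nat set"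
  proof -
    \<comment> \<open>The counting is for finite lists, so larger or infinite lists are trimmed to
      exactly this size.\<close>
    have "\<exists>K. K \<subseteq> L v \<and> finite K \<and> card K = \<chi>\<^sub>D T" if "v \<in> pverts T" for v
      using L that by (metis infinite_arbitrarily_large obtain_subset_with_card_n)
    then obtain K where K: "\<And>v. v \<in> pverts T \<Longrightarrow> K v \<subseteq> L v \<and> finite (K v) \<and> card (K v) = \<chi>\<^sub>D T"
      by metis
    have "\<exists>g. (\<forall>v\<in>set_rtree t. g v \<in> K v) \<and> good_code (map_rtree g t)"
      by (rule list_coloring_exists[OF V(1), of "f ` pverts T"])
        (use K f V pair_finite_verts in auto)
    then obtain g where g: "\<forall>v\<in>pverts T. g v \<in> K v" "good_code (map_rtree g t)"
      unfolding V(2) by blast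
    then show ?thesis
      unfolding properly_list_distinguishable_def
      using proper_distinguishing_iff_good_code[OF G t root, of g] K by blast
  qed
  then show "\<chi>\<^sub>D\<^sub>l T \<le> \<chi>\<^sub>D T"
    unfolding list_distinguishing_chromatic_number_def by (intro Least_le) blast
qed

end
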